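(* Let $S$ be the $(p,m,2)$ signed graph consisting of a positive edge, to which are attached $2$ positive pendant edges and $2$ negative pendant edges at one end as well as $r$ positive pendant edges at the other end. Then, for every integer $r\geq 2$, $S$ is additively graceful.
   Context: A signed graph $S$ is a finite simple graph on $p$ vertices in which $m$ edges are specified as positive and the remaining $n$ edges are specified as negative; it is then called a $(p,m,n)$ signed graph, with sets of positive and negative edges $E^+(S)$ and $E^-(S)$. Attaching a pendant edge at a vertex $z$ means adding a new vertex of degree 1 joined to $z$. Thus $S$ has positive edges $z_1z_2$, $z_1v_1$, $z_1v_2$, $z_2w_i$ ($1\le i\le r$) and negative edges $z_1u_1$, $z_1u_2$, all these vertices being distinct, and no other vertices or edges. An additively graceful labeling of a $(p,m,n)$ signed graph $S=(V,E)$ is an injective map $f:V\to\{0,1,\dots,m+\lceil\frac{n+1}{2}\rceil\}$ such that, with $f^*(uv)=f(u)+f(v)$ for $uv\in E^-(S)$ and $f^*(uv)=|f(u)-f(v)|$ for $uv\in E^+(S)$, one has $\{f^*(uv):uv\in E^-(S)\}=\{1,2,\dots,n\}$ and $\{f^*(uv):uv\in E^+(S)\}=\{1,2,\dots,m\}$. $S$ is additively graceful if it admits such a labeling. *)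

theory Defs
  imports Complex_Main
begin

record 'v signed_graph =
  verts :: "'v set"
  pos_edges :: "'v set set"
  neg_edges :: "'v set set"

definition wf_signed_graph :: "'v signed_graph \<Rightarrow> bool" where
  "wf_signed_graph S \<longleftrightarrow>
     finite (verts S) \<and>
     (\<forall>e \<in> pos_edges S \<union> neg_edges S. e \<subseteq> verts S \<and> card e = 2) \<and>
     pos_edges S \<inter> neg_edges S = {}"

definition pmn_signed_graph :: "nat \<Rightarrow> nat \<Rightarrow> nat \<Rightarrow> 'v signed_graph \<Rightarrow> bool" where
  "pmn_signed_graph p m n S \<longleftrightarrow>
     wf_signed_graph S \<and> card (verts S) = p \<and> card (pos_edges S) = m \<and> card (neg_edges S) = n"

definition neg_edge_labels :: "'v signed_graph \<Rightarrow> ('v \<Rightarrow> nat) \<Rightarrow> int set" where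
  "neg_edge_labels S f = {int (f u) + int (f v) | u v. {u, v} \<in> neg_edges S}"

definition pos_edge_labels :: "'v signed_graph \<Rightarrow> ('v \<Rightarrow> nat) \<Rightarrow> int set" where
  "pos_edge_labels S f = {\<bar>int (f u) - int (f v)\<bar> | u v. {u, v} \<in> pos_edges S}"

definition additively_graceful_labeling :: "'v signed_graph \<Rightarrow> ('v \<Rightarrow> nat) \<Rightarrow> bool" where
  "additively_graceful_labeling S f \<longleftrightarrow>
     (let m = card (pos_edges S); n = card (neg_edges S) in
        inj_on f (verts S) \<and>
        f ` verts S \<subseteq> {0..m + nat \<lceil>(real n + 1) / 2\<rceil>} \<and>
        neg_edge_labels S f = {1..int n} \<and>
        pos_edge_labels S f = {1..int m})"

definition additively_graceful :: "'v signed_graph \<Rightarrow> bool" where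
  "additively_graceful S \<longleftrightarrow> wf_signed_graph S \<and> (\<exists>f. additively_graceful_labeling S f)"

text \<open>
  The graph is specified up to isomorphism: any pairwise distinct elements of any type may serve
  as its vertices. The list \<open>ws\<close> enumerates the \<open>r\<close> pendant vertices attached at \<open>z2\<close>.
\<close>

definition pendant_signed_graph :: "nat \<Rightarrow> 'v signed_graph \<Rightarrow> bool" where
  "pendant_signed_graph r S \<longleftrightarrow>
     (\<exists>z1 z2 v1 v2 u1 u2 ws.
        length ws = r \<and>
        distinct ([z1, z2, v1, v2, u1, u2] @ ws) \<and>
        verts S = set ([z1, z2, v1, v2, u1, u2] @ ws) \<and>
        pos_edges S = {{z1, z2}, {z1, v1}, {z1, v2}} \<union> {{z2, w} | w. w \<in> set ws} \<and>
        neg_edges S = {{z1, u1}, {z1, u2}})"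

lemma pendant_signed_graph_pmn:
  assumes "pendant_signed_graph r S"
  shows "pmn_signed_graph (r + 6) (r + 3) 2 S"
proof -
  obtain z1 z2 v1 v2 u1 u2 ws where
    len: "length ws = r" and d: "distinct ([z1, z2, v1, v2, u1, u2] @ ws)" and
    V: "verts S = set ([z1, z2, v1, v2, u1, u2] @ ws)" and
    P: "pos_edges S = {{z1, z2}, {z1, v1}, {z1, v2}} \<union> {{z2, w} | w. w \<in> set ws}" and
    N: "neg_edges S = {{z1, u1}, {z1, u2}}"
    using assms unfolding pendant_signed_graph_def by (elim exE conjE) (rule that)
  have "e \<subseteq> verts S \<and> card e = 2" if "e \<in> pos_edges S \<union> neg_edges S" for e
  proof -
    from that consider x where "e = {z1, x}" "x \<in> {z2, v1, v2, u1, u2}"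
      | w where "e = {z2, w}" "w \<in> set ws"
      unfolding P N Un_iff insert_iff mem_Collect_eq empty_iff by metis
    then show ?thesis
    proof cases
      case 1
      then have "z1 \<noteq> x"
        using d by force
      with 1 show ?thesis
        unfolding V by simp blast
    next
      case 2
      then have "z2 \<noteq> w"
        using d by force
      with 2 show ?thesis
        unfolding V by simp
    qed
  qed
  moreover have "z1 \<notin> set ws" "z1 \<noteq> z2" "u1 \<noteq> z2" "u2 \<noteq> z2" "u1 \<noteq> v1" "u1 \<noteq> v2" "u2 \<noteq> v1" "u2 \<noteq> v2"
    using d by auto
  then have "pos_edges S \<inter> neg_edges S = {}"
    unfolding P N by (auto simp: doubleton_eq_iff)
  ultimately have wf: "wf_signed_graph S"
    unfolding wf_signed_graph_def V by (simp add: V)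
  have "card (verts S) = length ([z1, z2, v1, v2, u1, u2] @ ws)"
    unfolding V using d by (rule distinct_card)
  then have cV: "card (verts S) = r + 6"
    using len by simp
  have img: "{{z2, w} | w. w \<in> set ws} = (\<lambda>w. {z2, w}) ` set ws"
    by auto
  have "inj_on (\<lambda>w. {z2, w}) (set ws)"
    by (auto simp: inj_on_def doubleton_eq_iff)
  then have c1: "card {{z2, w} | w. w \<in> set ws} = r"
    unfolding img using d len by (simp add: card_image distinct_card)
  have c2: "card {{z1, z2}, {z1, v1}, {z1, v2}} = 3"
    using d by (auto simp: doubleton_eq_iff card_insert_if)
  have "{{z1, z2}, {z1, v1}, {z1, v2}} \<inter> {{z2, w} | w. w \<in> set ws} = {}"
    using d by (auto simp: doubleton_eq_iff)
  then have cP: "card (pos_edges S) = r + 3"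
    unfolding P using c1 c2 by (subst card_Un_disjoint) (auto simp: img)
  have cN: "card (neg_edges S) = 2"
    unfolding N using d by (auto simp: doubleton_eq_iff card_insert_if)
  show ?thesis
    unfolding pmn_signed_graph_def using wf cV cP cN by simp
qed

lemma pendant_signed_graph_exists: "\<exists>S :: nat signed_graph. pendant_signed_graph r S"
proof
  let ?ws = "[6..<r + 6]"
  show "pendant_signed_graph r \<lparr>verts = set ([0, 1, 2, 3, 4, 5] @ ?ws),
      pos_edges = {{0, 1}, {0, 2}, {0, 3}} \<union> {{1, w} | w. w \<in> set ?ws},
      neg_edges = {{0, 4}, {0, 5}}\<rparr>"
    unfolding pendant_signed_graph_def
    by (rule exI[of _ 0], rule exI[of _ 1], rule exI[of _ 2], rule exI[of _ 3], rule exI[of _ 4],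
        rule exI[of _ 5], rule exI[of _ ?ws]) (intro conjI; simp del: upt_Suc)
qed

end

theory Submission imports Defs begin

text \<open>
  Here \<open>m = r + 3\<close>, \<open>n = 2\<close> and the graph has \<open>r + 6\<close> vertices, so a labeling has to be a bijection
  onto \<open>{0..r + 5}\<close>. The negative labels 1 and 2 force \<open>z1\<close> to get 0 and \<open>u1, u2\<close> to get 1 and 2.
  A positive edge at \<open>z1\<close> is then labeled by its other end. Giving \<open>z2, v1, v2\<close> the labels
  \<open>r + 3, r + 2, r + 1\<close> therefore produces the three largest positive edge labels. What remains
  for the vertices \<open>w\<close> is \<open>{3..r} \<union> {r + 4, r + 5}\<close>, and the distances of these numbers from
  \<open>r + 3\<close> are \<open>3, \<dots>, r\<close> (the set \<open>{3..r}\<close> is reflected onto itself) together with 1 and 2.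
  So the positive edge labels are exactly \<open>1, \<dots>, r + 3\<close>. The assumption \<open>r \<ge> 2\<close> is what provides
  two vertices \<open>w\<close> for the labels \<open>r + 4\<close> and \<open>r + 5\<close>.
\<close>

text \<open>
  Both kinds of edge label are symmetric in the two ends, so each edge may be read off in one
  chosen direction instead of both.
\<close>

lemma pos_edge_labels_orientation:
  assumes "pos_edges S = (\<lambda>(u, v). {u, v}) ` A"
  shows "pos_edge_labels S f = (\<lambda>(u, v). \<bar>int (f u) - int (f v)\<bar>) ` A"
  unfolding pos_edge_labels_def assms
  by (force simp: doubleton_eq_iff image_iff abs_minus_commute)

lemma neg_edge_labels_orientation:
  assumes "neg_edges S = (\<lambda>(u, v). {u, v}) ` A"
  shows "neg_edge_labels S f = (\<lambda>(u, v). int (f u) + int (f v)) ` A"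
  unfolding neg_edge_labels_def assms
  by (force simp: doubleton_eq_iff image_iff add.commute)

lemma pendant_distances:
  fixes r :: nat
  assumes "r \<ge> 2"
  shows "(\<lambda>k. \<bar>int (r + 3) - int k\<bar>) ` ({3..r} \<union> {r + 4, r + 5}) = {1..int r}"
proof (intro equalityI subsetI)
  fix d
  assume "d \<in> {1..int r}"
  then consider "d = 1" | "d = 2" | "3 \<le> d" "d \<le> int r"
    by force
  then show "d \<in> (\<lambda>k. \<bar>int (r + 3) - int k\<bar>) ` ({3..r} \<union> {r + 4, r + 5})"
  proof cases
    case 3
    then have "nat (int r + 3 - d) \<in> {3..r}" "d = \<bar>int (r + 3) - int (nat (int r + 3 - d))\<bar>"
      by auto
    then show ?thesis
      by blast
  qed auto
qed (use assms in auto)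

theorem theorem4p6:
  fixes S :: "'v signed_graph" and r :: nat
  assumes "r \<ge> 2"
    and "pendant_signed_graph r S"
  shows "additively_graceful S"
proof -
  obtain z1 z2 v1 v2 u1 u2 ws where
    len: "length ws = r" and d: "distinct ([z1, z2, v1, v2, u1, u2] @ ws)" and
    V: "verts S = set ([z1, z2, v1, v2, u1, u2] @ ws)" and
    P: "pos_edges S = {{z1, z2}, {z1, v1}, {z1, v2}} \<union> {{z2, w} | w. w \<in> set ws}" and
    N: "neg_edges S = {{z1, u1}, {z1, u2}}"
    using assms(2) unfolding pendant_signed_graph_def by (elim exE conjE) (rule that)
  have pmn: "wf_signed_graph S" "card (pos_edges S) = r + 3" "card (neg_edges S) = 2"
    using pendant_signed_graph_pmn[OF assms(2)] unfolding pmn_signed_graph_def by auto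
  let ?L = "{3..r} \<union> {r + 4, r + 5}"
  have "card ?L = r"
    using assms(1) by (subst card_Un_disjoint) auto
  moreover have "card (set ws) = r"
    using d len by (simp add: distinct_card)
  \<comment> \<open>The vertices \<open>w\<close> are interchangeable, so any bijection onto the leftover labels will do.\<close>
  ultimately obtain g where g: "bij_betw g (set ws) ?L"
    using finite_same_card_bij[of "set ws" ?L] by auto
  define f where "f = g(z1 := 0, u1 := 1, u2 := 2, z2 := r + 3, v1 := r + 2, v2 := r + 1)"
  have f6: "f z1 = 0" "f u1 = 1" "f u2 = 2" "f z2 = r + 3" "f v1 = r + 2" "f v2 = r + 1"
    using d by (auto simp: f_def)
  have "f w = g w" if "w \<in> set ws" for w
    using d that by (auto simp: f_def)
  then have "bij_betw f (set ws) ?L"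
    using g by (simp cong: bij_betw_cong)
  then have inj: "inj_on f (set ws)" and img: "f ` set ws = ?L"
    by (auto simp: bij_betw_def)
  have fV: "f ` verts S = {0, r + 3, r + 2, r + 1, 1, 2} \<union> ?L"
    unfolding V set_append image_Un img by (simp add: f6)
  have "inj_on f (verts S)"
  proof -
    have "inj_on f (set [z1, z2, v1, v2, u1, u2])"
      using assms(1) by (auto simp: inj_on_def f6)
    moreover have "f ` set [z1, z2, v1, v2, u1, u2] \<inter> f ` set ws = {}"
      unfolding img using assms(1) by (auto simp: f6)
    ultimately show ?thesis
      unfolding V set_append inj_on_Un using inj by blast
  qed
  moreover have "f ` verts S \<subseteq> {0..r + 3 + nat \<lceil>(real 2 + 1) / 2\<rceil>}"
    unfolding fV by auto
  moreover have "neg_edge_labels S f = {1..int 2}"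
  proof -
    have "neg_edges S = (\<lambda>(u, v). {u, v}) ` {(z1, u1), (z1, u2)}"
      unfolding N by simp
    from neg_edge_labels_orientation[OF this] have "neg_edge_labels S f = {1, 2}"
      by (simp add: f6)
    also have "{1, 2} = {1..int 2}"
      by auto
    finally show ?thesis .
  qed
  moreover have "pos_edge_labels S f = {1..int (r + 3)}"
  proof -
    have "pos_edges S = (\<lambda>(u, v). {u, v}) ` ({z1} \<times> {z2, v1, v2} \<union> {z2} \<times> set ws)"
      unfolding P by auto
    from pos_edge_labels_orientation[OF this] have "pos_edge_labels S f =
        (\<lambda>v. \<bar>int (f z1) - int (f v)\<bar>) ` {z2, v1, v2} \<union> (\<lambda>k. \<bar>int (f z2) - int k\<bar>) ` f ` set ws"
      by (simp add: image_Un image_image) auto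
    also have "\<dots> = {int r + 3, int r + 2, int r + 1} \<union> {1..int r}"
      unfolding img f6(4) pendant_distances[OF assms(1)] by (simp add: f6 add.commute)
    also have "\<dots> = {1..int (r + 3)}"
      by auto
    finally show ?thesis .
  qed
  ultimately have "additively_graceful_labeling S f"
    unfolding additively_graceful_labeling_def Let_def pmn(2,3) by blast
  then show ?thesis
    unfolding additively_graceful_def using pmn(1) by blast
qed

end
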